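(* Let $X_1,X_2\subset\mathbb Z^m$ be digital images with adjacency $\kappa$ and $Y_1,Y_2\subset\mathbb Z^n$ digital images with adjacency $\lambda$. Suppose $X=X_1\wedge X_2$ is a wedge with wedge point $x_0$ and $Y=Y_1\wedge Y_2$ is a wedge with wedge point $y_0$. If $(X_1,x_0)\simeq^s_{\kappa,\lambda}(Y_1,y_0)$ and $(X_2,x_0)\simeq^s_{\kappa,\lambda}(Y_2,y_0)$, then $(X,x_0)\simeq^s_{\kappa,\lambda}(Y,y_0)$.
   Context: A digital image $(X,\kappa)$ is a set $X\subset\mathbb Z^n$ (for some $n\ge 1$) with an adjacency relation $\kappa$ (a symmetric, irreflexive relation). A subset is $\kappa$-connected if any two distinct points of it are joined by a finite sequence of points of the subset whose consecutive members are $\kappa$-adjacent. A function $f:(X,\kappa)\to(Y,\lambda)$ is $(\kappa,\lambda)$-continuous if it maps $\kappa$-connected sets to $\lambda$-connected sets; equivalently, $\kappa$-adjacent points are mapped to equal or $\lambda$-adjacent points. $[a,b]_{\mathbb Z}=\{z\in\mathbb Z: a\le z\le b\}$; subsets of $\mathbb Z$ carry the adjacency in which consecutive integers are adjacent. Homotopy: continuous $f,g:X\to Y$ are homotopic in $Y$, $f\simeq_{\kappa,\lambda} g$, if there are a positive integer $m$ and a function $F:X\times[0,m]_{\mathbb Z}\to Y$ with $F(x,0)=f(x)$, $F(x,m)=g(x)$ for all $x$, such that $t\mapsto F(x,t)$ is continuous for each $x\in X$ and $x\mapsto F(x,t)$ is $(\kappa,\lambda)$-continuous for each $t$. $F$ holds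 $x$ fixed if $F(x,t)=F(x,0)$ for all $t$. Homotopic similarity: $X\simeq^s_{\kappa,\lambda}Y$ if there are subsets $X_j'\subset X$, $Y_j'\subset Y$ ($j\ge1$) with $X_j'\subset X_{j+1}'$, $Y_j'\subset Y_{j+1}'$, $X=\bigcup_j X_j'$, $Y=\bigcup_j Y_j'$, and continuous $f_j:X_j'\to Y_j'$, $g_j:Y_j'\to X_j'$ such that $g_j\circ f_j\simeq_{\kappa,\kappa}1_{X_j'}$ (in $X_j'$), $f_j\circ g_j\simeq_{\lambda,\lambda}1_{Y_j'}$ (in $Y_j'$), and for $v\le w$, $f_w|_{X_v'}\simeq_{\kappa,\lambda}f_v$ in $Y_v'$ and $g_w|_{Y_v'}\simeq_{\lambda,\kappa}g_v$ in $X_v'$ (in particular $f_w(X_v')\subset Y_v'$ and $g_w(Y_v')\subset X_v'$). Pointed homotopic similarity $(X,x_0)\simeq^s_{\kappa,\lambda}(Y,y_0)$ means in addition $x_0\in X_1'$, $y_0\in Y_1'$, $f_j(x_0)=y_0$, $g_j(y_0)=x_0$ for all $j$, and all these homotopies hold the base point ($x_0$ or $y_0$, whichever lies in the domain) fixed. Wedge: if $X_1,X_2\subset\mathbb Z^m$ carry the same adjacency $\kappa$, $X_1\cap X_2=\{x_0\}$, and no point of $X_1\setminus\{x_0\}$ is $\kappa$-adjacent to a point of $X_2\setminus\{x_0\}$, then $X=X_1\cup X_2$ with adjacency $\kappa$ is the wedge $X_1\wedge X_2$, with wedge point $x_0$. *)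

theory Defs
  imports "HOL-Analysis.Finite_Cartesian_Product"
begin

text \<open>
  Points of the integer lattice are vectors of type \<open>int ^ 'n\<close>; the general notions below are
  stated for an arbitrary type of points so that they also apply to digital intervals in
  \<open>int\<close>. An adjacency is a binary relation on the whole point type, of which only the
  restriction to the carrier of the image matters. Likewise functions are total, and only their
  values on the carrier matter.
\<close>

definition digital_image :: "'a set \<Rightarrow> ('a \<Rightarrow> 'a \<Rightarrow> bool) \<Rightarrow> bool" where
  "digital_image X \<kappa> \<longleftrightarrow> symp_on X \<kappa> \<and> irreflp_on X \<kappa>"

definition dig_connected :: "('a \<Rightarrow> 'a \<Rightarrow> bool) \<Rightarrow> 'a set \<Rightarrow> bool" where
  "dig_connected \<kappa> A \<longleftrightarrow>
     (\<forall>x\<in>A. \<forall>y\<in>A. x \<noteq> y \<longrightarrow>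
        (\<exists>ps. ps \<noteq> [] \<and> set ps \<subseteq> A \<and> hd ps = x \<and> last ps = y \<and> successively \<kappa> ps))"

definition dig_continuous ::
  "'a set \<Rightarrow> ('a \<Rightarrow> 'a \<Rightarrow> bool) \<Rightarrow> 'b set \<Rightarrow> ('b \<Rightarrow> 'b \<Rightarrow> bool) \<Rightarrow> ('a \<Rightarrow> 'b) \<Rightarrow> bool" where
  "dig_continuous X \<kappa> Y \<mu> f \<longleftrightarrow>
     f ` X \<subseteq> Y \<and> (\<forall>A\<subseteq>X. dig_connected \<kappa> A \<longrightarrow> dig_connected \<mu> (f ` A))"

definition int_adj :: "int \<Rightarrow> int \<Rightarrow> bool" where
  "int_adj s t \<longleftrightarrow> \<bar>s - t\<bar> = 1"

definition dig_homotopy ::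
  "'a set \<Rightarrow> ('a \<Rightarrow> 'a \<Rightarrow> bool) \<Rightarrow> 'b set \<Rightarrow> ('b \<Rightarrow> 'b \<Rightarrow> bool) \<Rightarrow>
   ('a \<Rightarrow> 'b) \<Rightarrow> ('a \<Rightarrow> 'b) \<Rightarrow> int \<Rightarrow> ('a \<Rightarrow> int \<Rightarrow> 'b) \<Rightarrow> bool" where
  "dig_homotopy X \<kappa> Y \<mu> f g m F \<longleftrightarrow>
     m > 0 \<and> (\<forall>x\<in>X. F x 0 = f x) \<and> (\<forall>x\<in>X. F x m = g x) \<and>
     (\<forall>x\<in>X. dig_continuous {0..m} int_adj Y \<mu> (\<lambda>t. F x t)) \<and>
     (\<forall>t\<in>{0..m}. dig_continuous X \<kappa> Y \<mu> (\<lambda>x. F x t))"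

text \<open>Homotopy in \<open>Y\<close> of \<open>f\<close> and \<open>g\<close>, both restricted to \<open>X\<close>, holding \<open>x0\<close> fixed.\<close>

definition pointed_dig_homotopic ::
  "'a set \<Rightarrow> ('a \<Rightarrow> 'a \<Rightarrow> bool) \<Rightarrow> 'a \<Rightarrow> 'b set \<Rightarrow> ('b \<Rightarrow> 'b \<Rightarrow> bool) \<Rightarrow>
   ('a \<Rightarrow> 'b) \<Rightarrow> ('a \<Rightarrow> 'b) \<Rightarrow> bool" where
  "pointed_dig_homotopic X \<kappa> x0 Y \<mu> f g \<longleftrightarrow>
     dig_continuous X \<kappa> Y \<mu> f \<and> dig_continuous X \<kappa> Y \<mu> g \<and>
     (\<exists>m F. dig_homotopy X \<kappa> Y \<mu> f g m F \<and> (\<forall>t\<in>{0..m}. F x0 t = F x0 0))"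

definition pointed_homotopically_similar ::
  "'a set \<Rightarrow> ('a \<Rightarrow> 'a \<Rightarrow> bool) \<Rightarrow> 'a \<Rightarrow> 'b set \<Rightarrow> ('b \<Rightarrow> 'b \<Rightarrow> bool) \<Rightarrow> 'b \<Rightarrow> bool" where
  "pointed_homotopically_similar X \<kappa> x0 Y \<mu> y0 \<longleftrightarrow>
     (\<exists>(X' :: nat \<Rightarrow> 'a set) (Y' :: nat \<Rightarrow> 'b set) (f :: nat \<Rightarrow> 'a \<Rightarrow> 'b) (g :: nat \<Rightarrow> 'b \<Rightarrow> 'a).
        (\<forall>j\<ge>1. X' j \<subseteq> X' (j + 1) \<and> Y' j \<subseteq> Y' (j + 1)) \<and>
        X = (\<Union>j\<in>{1..}. X' j) \<and> Y = (\<Union>j\<in>{1..}. Y' j) \<and>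
        x0 \<in> X' 1 \<and> y0 \<in> Y' 1 \<and>
        (\<forall>j\<ge>1. dig_continuous (X' j) \<kappa> (Y' j) \<mu> (f j) \<and>
                dig_continuous (Y' j) \<mu> (X' j) \<kappa> (g j) \<and>
                f j x0 = y0 \<and> g j y0 = x0 \<and>
                pointed_dig_homotopic (X' j) \<kappa> x0 (X' j) \<kappa> (g j \<circ> f j) id \<and>
                pointed_dig_homotopic (Y' j) \<mu> y0 (Y' j) \<mu> (f j \<circ> g j) id) \<and>
        (\<forall>v\<ge>1. \<forall>w\<ge>v. pointed_dig_homotopic (X' v) \<kappa> x0 (Y' v) \<mu> (f w) (f v) \<and>
                pointed_dig_homotopic (Y' v) \<mu> y0 (X' v) \<kappa> (g w) (g v)))"

text \<open>\<open>X\<close> with adjacency \<open>\<kappa>\<close> is the wedge of \<open>X1\<close> and \<open>X2\<close> with wedge point \<open>x0\<close>.\<close>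

definition dig_wedge ::
  "'a set \<Rightarrow> ('a \<Rightarrow> 'a \<Rightarrow> bool) \<Rightarrow> 'a set \<Rightarrow> 'a set \<Rightarrow> 'a \<Rightarrow> bool" where
  "dig_wedge X \<kappa> X1 X2 x0 \<longleftrightarrow>
     digital_image X \<kappa> \<and> X = X1 \<union> X2 \<and> X1 \<inter> X2 = {x0} \<and>
     (\<forall>a\<in>X1 - {x0}. \<forall>b\<in>X2 - {x0}. \<not> \<kappa> a b)"

end

theory Submission
  imports Defs
begin

text \<open>
  Continuity is a condition on adjacent pairs, and in a wedge every adjacent pair lies in one of
  the two summands, so maps of the summands that agree at the wedge point glue to a
  continuous map. Base-point-preserving homotopies glue in the same way at each time, once the
  shorter one is prolonged by its final stage. Taking \<open>X' j = X1' j \<union> X2' j\<close> and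
  \<open>Y' j = Y1' j \<union> Y2' j\<close>, all data of the two similarities are glued this way.
\<close>

section \<open>Continuity as a condition on adjacent points\<close>

lemma successively_crossing:
  assumes "successively \<mu> ps" "ps \<noteq> []" "set ps \<subseteq> {p, q}" "hd ps = p" "last ps = q" "p \<noteq> q"
  shows "\<mu> p q"
  using assms
proof (induction ps)
  case (Cons a ps)
  then have "ps \<noteq> []" by auto
  \<comment> \<open>If the tail still starts at \<open>p\<close>, induction applies. Otherwise it
    starts at \<open>q\<close>, and the first step of the path is the wanted adjacency.\<close>
  with Cons show ?case
    by (cases "hd ps = p") (auto simp: successively_Cons dest: hd_in_set)
qed simp

text \<open>The image of a path may stall where neighbours share a value. Stalled entries are
  dropped, so \<open>qs\<close> may be shorter than \<open>map f ps\<close>.\<close>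

lemma successively_image:
  assumes "ps \<noteq> []" "successively \<kappa> ps"
    and "\<And>a b. a \<in> set ps \<Longrightarrow> b \<in> set ps \<Longrightarrow> \<kappa> a b \<Longrightarrow> f a = f b \<or> \<mu> (f a) (f b)"
  shows "\<exists>qs. qs \<noteq> [] \<and> set qs \<subseteq> f ` set ps \<and> hd qs = f (hd ps) \<and> last qs = f (last ps) \<and>
    successively \<mu> qs"
  using assms
proof (induction ps)
  case (Cons a ps)
  show ?case
  proof (cases "ps = []")
    case True
    then show ?thesis by (intro exI[of _ "[f a]"]) simp
  next
    case False
    with Cons obtain qs where qs: "qs \<noteq> []" "set qs \<subseteq> f ` set ps" "hd qs = f (hd ps)"
      "last qs = f (last ps)" "successively \<mu> qs"
      by (auto simp: successively_Cons)
    have "f a = f (hd ps) \<or> \<mu> (f a) (f (hd ps))"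
      using Cons.prems False by (auto simp: successively_Cons)
    then show ?thesis
    proof
      assume "f a = f (hd ps)"
      with qs False show ?thesis by (intro exI[of _ qs]) auto
    next
      assume "\<mu> (f a) (f (hd ps))"
      with qs False show ?thesis by (intro exI[of _ "f a # qs"]) (auto simp: successively_Cons)
    qed
  qed
qed simp

lemma dig_connected_doubleton:
  assumes "\<kappa> a b" "\<kappa> b a"
  shows "dig_connected \<kappa> {a, b}"
  unfolding dig_connected_def
proof (intro ballI impI)
  fix x y assume "x \<in> {a, b}" "y \<in> {a, b}" "x \<noteq> y"
  then show "\<exists>ps. ps \<noteq> [] \<and> set ps \<subseteq> {a, b} \<and> hd ps = x \<and> last ps = y \<and> successively \<kappa> ps"
    using assms by (intro exI[of _ "[x, y]"]) auto
qed

lemma dig_continuous_iff_adjacent: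
  assumes "symp_on X \<kappa>"
  shows "dig_continuous X \<kappa> Y \<mu> f \<longleftrightarrow>
    f ` X \<subseteq> Y \<and> (\<forall>a\<in>X. \<forall>b\<in>X. \<kappa> a b \<longrightarrow> f a = f b \<or> \<mu> (f a) (f b))"
    (is "?L \<longleftrightarrow> ?R")
proof
  assume L: ?L
  have "\<mu> (f a) (f b)" if ab: "a \<in> X" "b \<in> X" "\<kappa> a b" "f a \<noteq> f b" for a b
  proof -
    have "dig_connected \<kappa> {a, b}"
      using ab assms by (intro dig_connected_doubleton) (auto dest: symp_onD)
    moreover have "{a, b} \<subseteq> X" using ab by simp
    ultimately have "dig_connected \<mu> (f ` {a, b})"
      using L[unfolded dig_continuous_def, THEN conjunct2, rule_format, of "{a, b}"] by simp
    then obtain ps where "ps \<noteq> []" "set ps \<subseteq> {f a, f b}" "hd ps = f a" "last ps = f b"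
      "successively \<mu> ps"
      using ab(4) by (auto simp: dig_connected_def)
    then show ?thesis
      using successively_crossing[of \<mu> ps "f a" "f b"] ab(4) by simp
  qed
  with L show ?R unfolding dig_continuous_def by blast
next
  assume R: ?R
  have "dig_connected \<mu> (f ` A)" if A: "A \<subseteq> X" "dig_connected \<kappa> A" for A
    unfolding dig_connected_def
  proof (intro ballI impI)
    fix x y assume "x \<in> f ` A" "y \<in> f ` A" "x \<noteq> y"
    then obtain a b where ab: "a \<in> A" "b \<in> A" "x = f a" "y = f b" "a \<noteq> b" by blast
    with A obtain ps where ps: "ps \<noteq> []" "set ps \<subseteq> A" "hd ps = a" "last ps = b" "successively \<kappa> ps"
      unfolding dig_connected_def by blast
    have "f c = f d \<or> \<mu> (f c) (f d)" if "c \<in> set ps" "d \<in> set ps" "\<kappa> c d" for c d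
    proof -
      have "c \<in> X" "d \<in> X" using that ps(2) A(1) by auto
      with R that(3) show ?thesis by simp
    qed
    from successively_image[of ps \<kappa> f \<mu>, OF ps(1,5) this]
    obtain qs where qs: "qs \<noteq> []" "set qs \<subseteq> f ` set ps" "hd qs = x" "last qs = y"
      "successively \<mu> qs"
      using ps ab by auto
    moreover have "f ` set ps \<subseteq> f ` A" using ps(2) by (rule image_mono)
    ultimately show "\<exists>ps. ps \<noteq> [] \<and> set ps \<subseteq> f ` A \<and> hd ps = x \<and> last ps = y \<and> successively \<mu> ps"
      by (intro exI[of _ qs]) auto
  qed
  with R show ?L unfolding dig_continuous_def by blast
qed

section \<open>Gluing maps and homotopies over a wedge\<close>

lemma dig_wedge_sub:
  assumes "dig_wedge X \<kappa> X1 X2 x0" "A1 \<subseteq> X1" "A2 \<subseteq> X2" "x0 \<in> A1" "x0 \<in> A2"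
  shows "dig_wedge (A1 \<union> A2) \<kappa> A1 A2 x0"
proof -
  have "A1 \<union> A2 \<subseteq> X" using assms unfolding dig_wedge_def by blast
  then have "digital_image (A1 \<union> A2) \<kappa>"
    using assms unfolding dig_wedge_def digital_image_def symp_on_def irreflp_on_def by blast
  with assms show ?thesis unfolding dig_wedge_def by blast
qed

lemma dig_wedge_symp_on:
  assumes "dig_wedge A \<kappa> A1 A2 x0"
  shows "symp_on A \<kappa>" "symp_on A1 \<kappa>" "symp_on A2 \<kappa>"
  using assms unfolding dig_wedge_def digital_image_def symp_on_def by auto

text \<open>No adjacent pair straddles the two summands, so the local condition for \<open>h\<close>
  is inherited from \<open>f1\<close> or \<open>f2\<close>. Describing \<open>h\<close> by agreement
  with \<open>f1\<close> and \<open>f2\<close> lets the lemma serve glued maps, composites and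
  stages of homotopies alike.\<close>

lemma dig_continuous_wedge:
  assumes W: "dig_wedge A \<kappa> A1 A2 x0" and B: "B1 \<subseteq> B" "B2 \<subseteq> B"
    and "dig_continuous A1 \<kappa> B1 \<mu> f1" "dig_continuous A2 \<kappa> B2 \<mu> f2"
    and h: "\<forall>x\<in>A1. h x = f1 x" "\<forall>x\<in>A2. h x = f2 x"
  shows "dig_continuous A \<kappa> B \<mu> h"
proof -
  note symp = dig_wedge_symp_on[OF W]
  have f1: "f1 ` A1 \<subseteq> B1" "\<forall>a\<in>A1. \<forall>b\<in>A1. \<kappa> a b \<longrightarrow> f1 a = f1 b \<or> \<mu> (f1 a) (f1 b)"
    and f2: "f2 ` A2 \<subseteq> B2" "\<forall>a\<in>A2. \<forall>b\<in>A2. \<kappa> a b \<longrightarrow> f2 a = f2 b \<or> \<mu> (f2 a) (f2 b)"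
    using assms(4,5) symp by (simp_all add: dig_continuous_iff_adjacent)
  have A: "A = A1 \<union> A2" "A1 \<inter> A2 = {x0}" "\<forall>a\<in>A1 - {x0}. \<forall>b\<in>A2 - {x0}. \<not> \<kappa> a b"
    using W unfolding dig_wedge_def by auto
  have "h a = h b \<or> \<mu> (h a) (h b)" if ab: "a \<in> A" "b \<in> A" "\<kappa> a b" for a b
  proof -
    \<comment> \<open>The wedge condition excludes adjacency only from \<open>A1\<close> to
      \<open>A2\<close>; the reversed pair settles the case of \<open>a\<close> in \<open>A2\<close>
      and \<open>b\<close> in \<open>A1\<close>.\<close>
    have "\<kappa> b a" using symp(1) ab by (auto dest: symp_onD)
    then have "a \<in> A1 \<and> b \<in> A1 \<or> a \<in> A2 \<and> b \<in> A2" using A ab by blast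
    then show ?thesis using f1(2) f2(2) h ab(3) by metis
  qed
  moreover have "h ` A \<subseteq> B" using A(1) B f1(1) f2(1) h by (auto simp: image_subset_iff)
  ultimately show ?thesis using symp(1) by (simp add: dig_continuous_iff_adjacent)
qed

lemma symp_int_adj: "symp_on S int_adj"
  by (auto simp: symp_on_def int_adj_def)

text \<open>The homotopy rests at its final stage after time \<open>m\<close>. Replacing
  \<open>t\<close> by \<open>min t m\<close> sends consecutive times to equal or consecutive ones,
  so continuity in time survives. This gives two homotopies a common length.\<close>

lemma dig_homotopy_prolong:
  assumes "dig_homotopy X \<kappa> Y \<mu> f g m F" "m \<le> n"
  shows "dig_homotopy X \<kappa> Y \<mu> f g n (\<lambda>x t. F x (min t m))"
proof -
  have "dig_continuous {0..n} int_adj Y \<mu> (\<lambda>t. F x (min t m))" if "x \<in> X" for x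
  proof -
    have F: "F x ` {0..m} \<subseteq> Y"
      and adj: "\<And>s t. s \<in> {0..m} \<Longrightarrow> t \<in> {0..m} \<Longrightarrow> int_adj s t \<Longrightarrow> F x s = F x t \<or> \<mu> (F x s) (F x t)"
      using assms(1) that by (auto simp: dig_homotopy_def dig_continuous_iff_adjacent symp_int_adj)
    have "F x (min s m) = F x (min t m) \<or> \<mu> (F x (min s m)) (F x (min t m))"
      if st: "s \<in> {0..n}" "t \<in> {0..n}" "int_adj s t" for s t
    proof (cases "min s m = min t m")
      case False
      then have "int_adj (min s m) (min t m)" using st by (auto simp: int_adj_def)
      then show ?thesis using adj[of "min s m" "min t m"] assms st by (auto simp: dig_homotopy_def)
    qed simp
    moreover have "(\<lambda>t. F x (min t m)) ` {0..n} \<subseteq> Y"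
      using F assms(1) by (force simp: dig_homotopy_def)
    ultimately show ?thesis by (simp add: dig_continuous_iff_adjacent symp_int_adj)
  qed
  with assms show ?thesis by (auto simp: dig_homotopy_def)
qed

text \<open>Both homotopies keep the wedge point at \<open>f x0\<close> throughout, so their stages
  agree there at every time and can be glued.\<close>

lemma pointed_dig_homotopic_wedge:
  assumes W: "dig_wedge A \<kappa> A1 A2 x0" and B: "B1 \<subseteq> B" "B2 \<subseteq> B"
    and H1: "pointed_dig_homotopic A1 \<kappa> x0 B1 \<mu> f1 g1"
    and H2: "pointed_dig_homotopic A2 \<kappa> x0 B2 \<mu> f2 g2"
    and f: "\<forall>x\<in>A1. f x = f1 x" "\<forall>x\<in>A2. f x = f2 x"
    and g: "\<forall>x\<in>A1. g x = g1 x" "\<forall>x\<in>A2. g x = g2 x"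
  shows "pointed_dig_homotopic A \<kappa> x0 B \<mu> f g"
proof -
  have A: "A = A1 \<union> A2" "A1 \<inter> A2 = {x0}" "x0 \<in> A1" "x0 \<in> A2"
    using W unfolding dig_wedge_def by auto
  obtain m1 F1 where F1: "dig_homotopy A1 \<kappa> B1 \<mu> f1 g1 m1 F1" "\<forall>t\<in>{0..m1}. F1 x0 t = F1 x0 0"
    using H1 unfolding pointed_dig_homotopic_def by blast
  obtain m2 F2 where F2: "dig_homotopy A2 \<kappa> B2 \<mu> f2 g2 m2 F2" "\<forall>t\<in>{0..m2}. F2 x0 t = F2 x0 0"
    using H2 unfolding pointed_dig_homotopic_def by blast
  define m where "m = max m1 m2"
  define G1 where "G1 = (\<lambda>x t. F1 x (min t m1))"
  define G2 where "G2 = (\<lambda>x t. F2 x (min t m2))"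
  define F where "F = (\<lambda>x t. if x \<in> A1 then G1 x t else G2 x t)"
  have G1: "dig_homotopy A1 \<kappa> B1 \<mu> f1 g1 m G1"
    unfolding G1_def by (rule dig_homotopy_prolong[OF F1(1)]) (simp add: m_def)
  have G2: "dig_homotopy A2 \<kappa> B2 \<mu> f2 g2 m G2"
    unfolding G2_def by (rule dig_homotopy_prolong[OF F2(1)]) (simp add: m_def)
  have "m1 > 0" "m2 > 0" "F1 x0 0 = f1 x0" "F2 x0 0 = f2 x0"
    using F1(1) F2(1) A by (auto simp: dig_homotopy_def)
  \<comment> \<open>Clamping keeps the time inside the original interval of each homotopy, where the
    base point is held fixed.\<close>
  then have base: "G1 x0 t = f x0" "G2 x0 t = f x0" if "t \<in> {0..m}" for t
    using that F1(2)[rule_format, of "min t m1"] F2(2)[rule_format, of "min t m2"] f A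
    by (auto simp: G1_def G2_def)
  have FG: "F x t = G1 x t" if "x \<in> A1" for x t using that by (simp add: F_def)
  \<comment> \<open>Only \<open>x = x0\<close> needs an argument, since \<open>F\<close> uses
    \<open>G1\<close> there. The bound on \<open>t\<close> matters: at negative times nothing
    relates \<open>G1 x0 t\<close> to \<open>G2 x0 t\<close>.\<close>
  have FG2: "F x t = G2 x t" if "x \<in> A2" "t \<in> {0..m}" for x t
    using that A base[OF that(2)] by (cases "x = x0") (auto simp: F_def)
  have "m > 0" using G1 by (simp add: dig_homotopy_def)
  \<comment> \<open>The track of a single point comes from one summand alone, so only the codomain
    has to be enlarged; gluing enters in \<open>slice\<close>.\<close>
  have line: "dig_continuous {0..m} int_adj B \<mu> (\<lambda>t. F x t)" if "x \<in> A" for x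
  proof (cases "x \<in> A1")
    case True
    then have "dig_continuous {0..m} int_adj B1 \<mu> (\<lambda>t. F x t)"
      using G1 by (simp add: dig_homotopy_def F_def)
    then show ?thesis using B unfolding dig_continuous_def by blast
  next
    case False
    then have "dig_continuous {0..m} int_adj B2 \<mu> (\<lambda>t. F x t)"
      using G2 that A by (auto simp: dig_homotopy_def F_def)
    then show ?thesis using B unfolding dig_continuous_def by blast
  qed
  have slice: "dig_continuous A \<kappa> B \<mu> (\<lambda>x. F x t)" if "t \<in> {0..m}" for t
  proof (rule dig_continuous_wedge[OF W B])
    show "dig_continuous A1 \<kappa> B1 \<mu> (\<lambda>x. G1 x t)" "dig_continuous A2 \<kappa> B2 \<mu> (\<lambda>x. G2 x t)"
      using G1 G2 that by (auto simp: dig_homotopy_def)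
  qed (use that FG FG2 in auto)
  have ends: "F x 0 = f x" "F x m = g x" if "x \<in> A" for x
    using that G1 G2 f g A \<open>m > 0\<close> by (auto simp: dig_homotopy_def F_def)
  have "dig_homotopy A \<kappa> B \<mu> f g m F"
    using \<open>m > 0\<close> line slice ends by (simp add: dig_homotopy_def)
  moreover have "\<forall>t\<in>{0..m}. F x0 t = F x0 0"
    using base FG A \<open>m > 0\<close> by simp
  moreover have "dig_continuous A \<kappa> B \<mu> f"
    using H1 H2 by (intro dig_continuous_wedge[OF W B _ _ f]) (auto simp: pointed_dig_homotopic_def)
  moreover have "dig_continuous A \<kappa> B \<mu> g"
    using H1 H2 by (intro dig_continuous_wedge[OF W B _ _ g]) (auto simp: pointed_dig_homotopic_def)
  ultimately show ?thesis unfolding pointed_dig_homotopic_def by blast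
qed

section \<open>Assembling the similarity of the two wedges\<close>

definition glue :: "'a set \<Rightarrow> ('a \<Rightarrow> 'b) \<Rightarrow> ('a \<Rightarrow> 'b) \<Rightarrow> 'a \<Rightarrow> 'b" where
  "glue S f1 f2 x = (if x \<in> S then f1 x else f2 x)"

lemma glue_eq:
  assumes "S \<inter> T = {x0}" "f1 x0 = f2 x0"
  shows "x \<in> S \<Longrightarrow> glue S f1 f2 x = f1 x" "x \<in> T \<Longrightarrow> glue S f1 f2 x = f2 x"
  using assms by (auto simp: glue_def)

theorem theorem8p1:
  fixes X X1 X2 :: "(int ^ 'm) set" and \<kappa> :: "int ^ 'm \<Rightarrow> int ^ 'm \<Rightarrow> bool" and x0 :: "int ^ 'm"
    and Y Y1 Y2 :: "(int ^ 'n) set" and \<mu> :: "int ^ 'n \<Rightarrow> int ^ 'n \<Rightarrow> bool" and y0 :: "int ^ 'n"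
  assumes "digital_image X1 \<kappa>" and "digital_image X2 \<kappa>"
    and "digital_image Y1 \<mu>" and "digital_image Y2 \<mu>"
    and "dig_wedge X \<kappa> X1 X2 x0" and "dig_wedge Y \<mu> Y1 Y2 y0"
    and "pointed_homotopically_similar X1 \<kappa> x0 Y1 \<mu> y0"
    and "pointed_homotopically_similar X2 \<kappa> x0 Y2 \<mu> y0"
  shows "pointed_homotopically_similar X \<kappa> x0 Y \<mu> y0"
proof -
  note WX = assms(5) and WY = assms(6)
  obtain X1' Y1' f1 g1 where
    mono1: "\<forall>j\<ge>1. X1' j \<subseteq> X1' (j + 1) \<and> Y1' j \<subseteq> Y1' (j + 1)" and
    un1: "X1 = (\<Union>j\<in>{1::nat..}. X1' j)" "Y1 = (\<Union>j\<in>{1::nat..}. Y1' j)" and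
    pt1: "x0 \<in> X1' 1" "y0 \<in> Y1' 1" and
    eqv1: "\<forall>j\<ge>1. dig_continuous (X1' j) \<kappa> (Y1' j) \<mu> (f1 j) \<and>
      dig_continuous (Y1' j) \<mu> (X1' j) \<kappa> (g1 j) \<and> f1 j x0 = y0 \<and> g1 j y0 = x0 \<and>
      pointed_dig_homotopic (X1' j) \<kappa> x0 (X1' j) \<kappa> (g1 j \<circ> f1 j) id \<and>
      pointed_dig_homotopic (Y1' j) \<mu> y0 (Y1' j) \<mu> (f1 j \<circ> g1 j) id" and
    comp1: "\<forall>v\<ge>1. \<forall>w\<ge>v. pointed_dig_homotopic (X1' v) \<kappa> x0 (Y1' v) \<mu> (f1 w) (f1 v) \<and>
      pointed_dig_homotopic (Y1' v) \<mu> y0 (X1' v) \<kappa> (g1 w) (g1 v)"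
    using assms(7) unfolding pointed_homotopically_similar_def by blast
  obtain X2' Y2' f2 g2 where
    mono2: "\<forall>j\<ge>1. X2' j \<subseteq> X2' (j + 1) \<and> Y2' j \<subseteq> Y2' (j + 1)" and
    un2: "X2 = (\<Union>j\<in>{1::nat..}. X2' j)" "Y2 = (\<Union>j\<in>{1::nat..}. Y2' j)" and
    pt2: "x0 \<in> X2' 1" "y0 \<in> Y2' 1" and
    eqv2: "\<forall>j\<ge>1. dig_continuous (X2' j) \<kappa> (Y2' j) \<mu> (f2 j) \<and>
      dig_continuous (Y2' j) \<mu> (X2' j) \<kappa> (g2 j) \<and> f2 j x0 = y0 \<and> g2 j y0 = x0 \<and>
      pointed_dig_homotopic (X2' j) \<kappa> x0 (X2' j) \<kappa> (g2 j \<circ> f2 j) id \<and>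
      pointed_dig_homotopic (Y2' j) \<mu> y0 (Y2' j) \<mu> (f2 j \<circ> g2 j) id" and
    comp2: "\<forall>v\<ge>1. \<forall>w\<ge>v. pointed_dig_homotopic (X2' v) \<kappa> x0 (Y2' v) \<mu> (f2 w) (f2 v) \<and>
      pointed_dig_homotopic (Y2' v) \<mu> y0 (X2' v) \<kappa> (g2 w) (g2 v)"
    using assms(8) unfolding pointed_homotopically_similar_def by blast
  define X' where "X' = (\<lambda>j. X1' j \<union> X2' j)"
  define Y' where "Y' = (\<lambda>j. Y1' j \<union> Y2' j)"
  \<comment> \<open>The case distinction is on the whole summand \<open>X1\<close>, not on the stage
    \<open>X1' j\<close>, so one description of \<open>f j\<close> is valid on every stage
    \<open>X' v\<close>. The same holds for \<open>g\<close>.\<close>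
  define f where "f = (\<lambda>j. glue X1 (f1 j) (f2 j))"
  define g where "g = (\<lambda>j. glue Y1 (g1 j) (g2 j))"
  \<comment> \<open>The base points are given in the first stages only; monotonicity carries them to
    all later ones.\<close>
  have ptX: "x0 \<in> X1' j \<and> x0 \<in> X2' j" and ptY: "y0 \<in> Y1' j \<and> y0 \<in> Y2' j" if "j \<ge> 1" for j
    using that by (induction j rule: dec_induct) (use pt1 pt2 mono1 mono2 in auto)
  have subX: "X1' j \<subseteq> X1" "X2' j \<subseteq> X2" and subY: "Y1' j \<subseteq> Y1" "Y2' j \<subseteq> Y2"
    if "j \<ge> 1" for j
    using that un1 un2 by auto
  \<comment> \<open>Each stage is itself a wedge, so the gluing lemmas apply stage by stage.\<close>
  have wX: "dig_wedge (X' j) \<kappa> (X1' j) (X2' j) x0"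
    and wY: "dig_wedge (Y' j) \<mu> (Y1' j) (Y2' j) y0" if "j \<ge> 1" for j
    unfolding X'_def Y'_def
    using dig_wedge_sub[OF WX subX[OF that]] dig_wedge_sub[OF WY subY[OF that]]
      ptX[OF that] ptY[OF that] by blast+
  have incl: "X1' j \<subseteq> X' j" "X2' j \<subseteq> X' j" "Y1' j \<subseteq> Y' j" "Y2' j \<subseteq> Y' j" for j
    by (auto simp: X'_def Y'_def)
  have fpt: "f1 j x0 = y0" "f2 j x0 = y0" and gpt: "g1 j y0 = x0" "g2 j y0 = x0" if "j \<ge> 1" for j
    using that eqv1 eqv2 by auto
  have intX: "X1 \<inter> X2 = {x0}" and intY: "Y1 \<inter> Y2 = {y0}"
    using WX WY unfolding dig_wedge_def by auto
  have f_X1: "f j x = f1 j x" if "j \<ge> 1" "x \<in> X1" for j x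
    unfolding f_def by (rule glue_eq[OF intX]) (use that fpt in auto)
  have f_X2: "f j x = f2 j x" if "j \<ge> 1" "x \<in> X2" for j x
    unfolding f_def by (rule glue_eq[OF intX]) (use that fpt in auto)
  have g_Y1: "g j y = g1 j y" if "j \<ge> 1" "y \<in> Y1" for j y
    unfolding g_def by (rule glue_eq[OF intY]) (use that gpt in auto)
  have g_Y2: "g j y = g2 j y" if "j \<ge> 1" "y \<in> Y2" for j y
    unfolding g_def by (rule glue_eq[OF intY]) (use that gpt in auto)
  \<comment> \<open>The index \<open>j\<close> of the map and the index \<open>v\<close> of the
    stage vary independently, because comparing \<open>f w\<close> with \<open>f v\<close> needs
    both maps on stage \<open>v\<close>.\<close>
  have f_eq: "\<forall>x\<in>X1' v. f j x = f1 j x" "\<forall>x\<in>X2' v. f j x = f2 j x"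
    and g_eq: "\<forall>y\<in>Y1' v. g j y = g1 j y" "\<forall>y\<in>Y2' v. g j y = g2 j y"
    if "j \<ge> 1" "v \<ge> 1" for j v
    using f_X1[OF that(1)] f_X2[OF that(1)] g_Y1[OF that(1)] g_Y2[OF that(1)]
      subX[OF that(2)] subY[OF that(2)] by blast+
  have cf: "dig_continuous (X' j) \<kappa> (Y' j) \<mu> (f j)"
    and cg: "dig_continuous (Y' j) \<mu> (X' j) \<kappa> (g j)" if "j \<ge> 1" for j
    using dig_continuous_wedge[OF wX incl(3,4) _ _ f_eq] dig_continuous_wedge[OF wY incl(1,2) _ _ g_eq]
      that eqv1 eqv2 by blast+
  have img: "f1 j ` X1' j \<subseteq> Y1' j" "f2 j ` X2' j \<subseteq> Y2' j" "g1 j ` Y1' j \<subseteq> X1' j" "g2 j ` Y2' j \<subseteq> X2' j"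
    if "j \<ge> 1" for j
    using that eqv1 eqv2 by (auto simp: dig_continuous_def)
  \<comment> \<open>Since \<open>f1 j\<close> sends \<open>X1' j\<close> into \<open>Y1' j\<close>,
    where \<open>g j\<close> is \<open>g1 j\<close>, the composite never switches summands; likewise
    for the other three.\<close>
  have gf_eq: "\<forall>x\<in>X1' j. (g j \<circ> f j) x = (g1 j \<circ> f1 j) x" "\<forall>x\<in>X2' j. (g j \<circ> f j) x = (g2 j \<circ> f2 j) x"
    and fg_eq: "\<forall>y\<in>Y1' j. (f j \<circ> g j) y = (f1 j \<circ> g1 j) y" "\<forall>y\<in>Y2' j. (f j \<circ> g j) y = (f2 j \<circ> g2 j) y"
    if "j \<ge> 1" for j
    using f_eq[OF that that] g_eq[OF that that] img[OF that] by (simp_all add: image_subset_iff)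
  have hgf: "pointed_dig_homotopic (X' j) \<kappa> x0 (X' j) \<kappa> (g j \<circ> f j) id" if "j \<ge> 1" for j
    by (rule pointed_dig_homotopic_wedge[OF wX[OF that] incl(1,2) _ _ gf_eq[OF that]])
      (use that eqv1 eqv2 in blast)+
  have hfg: "pointed_dig_homotopic (Y' j) \<mu> y0 (Y' j) \<mu> (f j \<circ> g j) id" if "j \<ge> 1" for j
    by (rule pointed_dig_homotopic_wedge[OF wY[OF that] incl(3,4) _ _ fg_eq[OF that]])
      (use that eqv1 eqv2 in blast)+
  \<comment> \<open>The maps of index \<open>w\<close> are compared on stage \<open>v\<close>, with
    homotopies inside stage \<open>v\<close> of the target, as \<open>comp1\<close> and
    \<open>comp2\<close> provide on each summand.\<close>
  have hf: "pointed_dig_homotopic (X' v) \<kappa> x0 (Y' v) \<mu> (f w) (f v)"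
    and hg: "pointed_dig_homotopic (Y' v) \<mu> y0 (X' v) \<kappa> (g w) (g v)" if "v \<ge> 1" "w \<ge> v" for v w
  proof -
    have w: "w \<ge> 1" using that by simp
    show "pointed_dig_homotopic (X' v) \<kappa> x0 (Y' v) \<mu> (f w) (f v)"
      by (rule pointed_dig_homotopic_wedge[OF wX[OF that(1)] incl(3,4) _ _
            f_eq[OF w that(1)] f_eq[OF that(1) that(1)]]) (use that comp1 comp2 in blast)+
    show "pointed_dig_homotopic (Y' v) \<mu> y0 (X' v) \<kappa> (g w) (g v)"
      by (rule pointed_dig_homotopic_wedge[OF wY[OF that(1)] incl(1,2) _ _
            g_eq[OF w that(1)] g_eq[OF that(1) that(1)]]) (use that comp1 comp2 in blast)+
  qed
  have "x0 \<in> X1" "y0 \<in> Y1" using intX intY by auto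
  then have base: "f j x0 = y0" "g j y0 = x0" if "j \<ge> 1" for j
    using that by (simp_all add: f_X1 g_Y1 fpt gpt)
  have mono: "X' j \<subseteq> X' (j + 1) \<and> Y' j \<subseteq> Y' (j + 1)" if "j \<ge> 1" for j
    using that mono1 mono2 unfolding X'_def Y'_def by blast
  have "X = X1 \<union> X2" "Y = Y1 \<union> Y2"
    using WX WY by (simp_all add: dig_wedge_def)
  then have un: "X = (\<Union>j\<in>{1..}. X' j)" "Y = (\<Union>j\<in>{1..}. Y' j)"
    unfolding un1 un2 X'_def Y'_def by blast+
  have pt: "x0 \<in> X' 1" "y0 \<in> Y' 1"
    using pt1 pt2 by (auto simp: X'_def Y'_def)
  show ?thesis
    unfolding pointed_homotopically_similar_def
    by (intro exI[of _ X'] exI[of _ Y'] exI[of _ f] exI[of _ g] conjI allI impI)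
      (fact un | fact pt | erule mono[THEN conjunct1] mono[THEN conjunct2] cf cg base hgf hfg
        | erule (1) hf hg)+
qed

end
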